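(* Let $S$ be one-dimensional simple random walk started at $0$. There exists a constant $K>0$ such that for every positive integer $n$ and every real $r\geq 1$, $$\mathbb{P}\{|S(2n)|\geq r\sqrt{n}\}\leq K\exp\Big\{-\frac{r^2}{4}\Big\}.$$
   Context: One-dimensional simple random walk is $S(n)=\sum_{i=1}^n X_i$ with $X_i$ independent and $\mathbb{P}\{X_i=1\}=\mathbb{P}\{X_i=-1\}=\frac12$. *)

theory Defs
  imports "HOL-Probability.Probability"
begin

text \<open>The steps are real-valued random variables indexed by the positive integers, so that they
  take the values \<open>1\<close> and \<open>-1\<close> almost surely; \<open>X 0\<close> plays no role.\<close>

locale simple_random_walk = prob_space M for M :: "'a measure" +
  fixes X :: "nat \<Rightarrow> 'a \<Rightarrow> real"
  assumes indep_steps: "indep_vars (\<lambda>_. borel) X {1..}"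
    and prob_step_up: "\<And>i. i \<ge> 1 \<Longrightarrow> \<P>(\<omega> in M. X i \<omega> = 1) = 1 / 2"
    and prob_step_down: "\<And>i. i \<ge> 1 \<Longrightarrow> \<P>(\<omega> in M. X i \<omega> = - 1) = 1 / 2"

definition walk :: "(nat \<Rightarrow> 'a \<Rightarrow> real) \<Rightarrow> nat \<Rightarrow> 'a \<Rightarrow> real" where
  "walk X n \<omega> = (\<Sum>i = 1..n. X i \<omega>)"

end

theory Submission
  imports Defs
begin

text \<open>Each step lies in \<open>{- 1..1}\<close> and has mean \<open>0\<close>, so Hoeffding's inequality for \<open>2 * n\<close> steps bounds
  the probability by \<open>2 * exp (- (2 * r\<^sup>2 * n / (2 * n * 2\<^sup>2))) = 2 * exp (- (r\<^sup>2 / 4))\<close>.\<close>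

context simple_random_walk
begin

lemma random_variable_step: "i \<ge> 1 \<Longrightarrow> random_variable borel (X i)"
  using indep_steps unfolding indep_vars_def by auto

text \<open>The events of a step up and a step down are disjoint and have probability
  \<open>1 / 2\<close> each, so together they exhaust the mass. This gives the almost sure bounds
  that Hoeffding's inequality asks for.\<close>

lemma AE_step:
  assumes "i \<ge> 1"
  shows "AE \<omega> in M. X i \<omega> = 1 \<or> X i \<omega> = - 1"
proof -
  note [measurable] = random_variable_step[OF assms]
  have "\<P>(\<omega> in M. X i \<omega> = 1 \<or> X i \<omega> = - 1) =
      prob ({\<omega> \<in> space M. X i \<omega> = 1} \<union> {\<omega> \<in> space M. X i \<omega> = - 1})"
    by (rule arg_cong[where f = prob]) auto
  also have "\<dots> = prob {\<omega> \<in> space M. X i \<omega> = 1} + prob {\<omega> \<in> space M. X i \<omega> = - 1}"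
    by (rule finite_measure_Union) auto
  also have "\<dots> = 1"
    using prob_step_up[OF assms] prob_step_down[OF assms] by simp
  finally show ?thesis
    by (subst (asm) prob_Collect_eq_1) auto
qed

text \<open>Almost surely \<open>X i\<close> is the indicator of \<open>U\<close> minus that of
  \<open>D\<close>, and these two events are equally likely.\<close>

lemma expectation_step:
  assumes "i \<ge> 1"
  shows "expectation (X i) = 0"
proof -
  note [measurable] = random_variable_step[OF assms]
  define U D where "U = {\<omega> \<in> space M. X i \<omega> = 1}" and "D = {\<omega> \<in> space M. X i \<omega> = - 1}"
  have [measurable]: "U \<in> events" "D \<in> events"
    by (auto simp: U_def D_def)
  have "expectation (X i) = expectation (\<lambda>\<omega>. indicator U \<omega> - indicator D \<omega>)"
  proof (rule integral_cong_AE)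
    show "AE \<omega> in M. X i \<omega> = indicator U \<omega> - indicator D \<omega>"
      using AE_step[OF assms] AE_space
      by eventually_elim (auto simp: U_def D_def indicator_def)
  qed auto
  also have "\<dots> = prob U - prob D"
    \<comment> \<open>Both indicators are integrable because the measure is finite;
      \<open>less_top\<close> brings this into the required form.\<close>
    by (subst Bochner_Integration.integral_diff) (auto simp: less_top[symmetric])
  also have "\<dots> = 0"
    using prob_step_up[OF assms] prob_step_down[OF assms] by (simp add: U_def D_def)
  finally show ?thesis .
qed

text \<open>Each of the \<open>m\<close> ranges has width \<open>2\<close>, so the squared widths
  sum to \<open>4 * m\<close> and Hoeffding's exponent is
  \<open>2 * \<epsilon>\<^sup>2 / (4 * m)\<close>. The factor \<open>2\<close> accounts for the two
  tails.\<close>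

lemma prob_abs_walk_ge:
  assumes "m \<ge> 1" and "\<epsilon> \<ge> 0"
  shows "\<P>(\<omega> in M. \<bar>walk X m \<omega>\<bar> \<ge> \<epsilon>) \<le> 2 * exp (- (\<epsilon>\<^sup>2 / (2 * real m)))"
proof -
  \<comment> \<open>The centre is given as the sum of the expectations, as the locale defines it;
    that it vanishes is shown afterwards.\<close>
  interpret Hoeffding_ineq M "{1..m}" X "\<lambda>_. - 1" "\<lambda>_. 1" "\<Sum>i = 1..m. expectation (X i)"
  proof unfold_locales
    show "indep_vars (\<lambda>_. borel) X {1..m}"
      by (rule indep_vars_subset[OF indep_steps]) auto
    show "AE \<omega> in M. X i \<omega> \<in> {- 1..1}" if "i \<in> {1..m}" for i
      using AE_step[of i] that by (auto elim: eventually_mono)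
  qed auto
  have "(\<Sum>i = 1..m. expectation (X i)) = 0"
    by (rule sum.neutral) (auto intro: expectation_step)
  then show ?thesis
    using Hoeffding_ineq_abs_ge[OF \<open>\<epsilon> \<ge> 0\<close>] assms(1)
    by (simp add: walk_def)
qed

end

theorem corollary3p2:
  shows "\<exists>K>0::real. \<forall>(M :: 'a measure) X. simple_random_walk M X \<longrightarrow>
           (\<forall>n::nat. \<forall>r::real. n \<ge> 1 \<longrightarrow> r \<ge> 1 \<longrightarrow>
              \<P>(\<omega> in M. \<bar>walk X (2 * n) \<omega>\<bar> \<ge> r * sqrt (real n)) \<le> K * exp (- (r\<^sup>2 / 4)))"
\<comment> \<open>The witness \<open>2\<close> is the two-tail factor, the same for every walk,
  \<open>n\<close> and \<open>r\<close>.\<close>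
proof (intro exI[of _ 2] conjI allI impI)
  fix M :: "'a measure" and X :: "nat \<Rightarrow> 'a \<Rightarrow> real" and n :: nat and r :: real
  assume "simple_random_walk M X" and n: "n \<ge> 1" and r: "r \<ge> 1"
  then interpret simple_random_walk M X
    by simp
  have "\<P>(\<omega> in M. \<bar>walk X (2 * n) \<omega>\<bar> \<ge> r * sqrt (real n)) \<le>
      2 * exp (- ((r * sqrt (real n))\<^sup>2 / (2 * real (2 * n))))"
    using n r by (intro prob_abs_walk_ge) auto
  also have "(r * sqrt (real n))\<^sup>2 / (2 * real (2 * n)) = r\<^sup>2 / 4"
    \<comment> \<open>Since \<open>n\<close> is nonzero, it cancels from
      \<open>r\<^sup>2 * n / (4 * n)\<close>.\<close>
    using n by (simp add: power_mult_distrib)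
  finally show "\<P>(\<omega> in M. \<bar>walk X (2 * n) \<omega>\<bar> \<ge> r * sqrt (real n)) \<le> 2 * exp (- (r\<^sup>2 / 4))" .
qed simp

end
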